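(* Assume the dynamics are $f(x,u,w)=f_\mathrm{a}(x,u)+w$ with $w\in\mathbb{R}^n$ and disturbance constraint set $\mathcal{W}\subseteq\mathbb{R}^n$, $0\in\mathcal{W}$; the stage cost is $l(x,w;(u,y))=|w|_Q^2+|y-h(x,u)|_R^2$ with $Q,R\succ0$; $\mathcal{X}$, $\mathcal{W}$ and $\mathcal{V}$ are compact; the turnpike property of the context holds; and $f_\mathrm{a}$, $h$ are Lipschitz in $x$ on $\mathcal{X}$ uniformly in $u\in\mathcal{U}$. Then there exist $A>0$ and $\bar\sigma\in\mathcal{L}$ such that for every $\epsilon>0$, every even $N\ge0$, every $\delta\in\{0,\dots,N/2\}$, every $t\ge\delta$, all integers $t_1\le t_2$ in $\{\delta,\dots,t-\delta\}$, and all possible data sequences, $$J_{[t_1,t_2]}(\hat z^{\delta\mathrm{mhe}}_{t_1:t_2})-J_{[t_1,t_2]}(z^\infty_{t_1:t_2})\leq t_\Delta\Big(\epsilon A+\frac{1+\epsilon}{\epsilon}\bar\sigma(\delta)\Big),\qquad t_\Delta=t_2-t_1.$$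
   Context: System: $x_{t+1}=f(x_t,u_t,w_t)$, $y_t=h(x_t,u_t)+v_t$, $f,h$ continuous; known sets $\mathcal{X}\subseteq\mathbb{R}^n$, $\mathcal{U}$, $\mathcal{W}$, $\mathcal{V}\subseteq\mathbb{R}^p$ with $f(\mathcal{X}\times\mathcal{U}\times\mathcal{W})\subseteq\mathcal{X}$. Data $d_t=(u_t,y_t)$; a possible data sequence $(d_t)_{t\in\mathbb{Z}}$ is generated for all $t\in\mathbb{Z}$ by a trajectory with $(x_t,u_t,w_t,v_t)\in\mathcal{X}\times\mathcal{U}\times\mathcal{W}\times\mathcal{V}$. $|x|_Q^2=x^\top Qx$. $P_N(d_{a:a+N})$: minimize $\sum_{j=0}^{N-1}l(\hat x_j,\hat w_j;d_{a+j})+g(\hat x_N;d_{a+N})$ (continuous terminal cost $g\ge0$) subject to $\hat x_{j+1}=f(\hat x_j,u_{a+j},\hat w_j)$, $\hat x_j\in\mathcal{X}$, $\hat w_j\in\mathcal{W}$, $y_{a+j}-h(\hat x_j,u_{a+j})\in\mathcal{V}$; solutions assumed to exist; $\zeta_N(j,d_{a:a+N})=\hat z^*_j$ ($(\hat x^*_j,\hat w^*_j)$ for $j<N$, $(\hat x^*_N,0)$ for $j=N$), with state part $\zeta^x_N$ (index relative to window start). $P_\infty(d_{-\infty:\infty})$: minimize $\sum_{j\in\mathbb{Z}}l(\hat x_j,\hat w_j;d_j)$ under the same constraints for all $j\in\mathbb{Z}$; unique solution $z^\infty_j=(x^\infty_j,w^\infty_j)$ assumed. $\mathcal{L}$: continuous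 non-increasing functions $\mathbb{R}_{\ge0}\to\mathbb{R}_{\ge0}$ tending to $0$; $\mathcal{KL}$: standard. Turnpike property: there is $\beta\in\mathcal{KL}$ with $|\hat z^*_j-z^\infty_{a+j}|\le\beta(|\hat z^*_0-z^\infty_a|,j)+\beta(|\hat z^*_N-z^\infty_{a+N}|,N-j)$ for all $j\in\{0,\dots,N\}$, where $\hat z^*_j=\zeta_N(j,d_{a:a+N})$, for all possible data, $N\ge0$, $a\in\mathbb{Z}$. $\delta$MHE: for even $N$, $\delta\in\{0,\dots,N/2\}$, $t\ge\delta$: $\hat x^{\delta\mathrm{mhe}}_{t-\delta}=\zeta^x_N(N-\delta,d_{t-N:t})$ if $t\ge N$, $=\zeta^x_t(t-\delta,d_{0:t})$ if $\delta\le t\le N-1$. For fixed $t$: $\hat w^{\delta\mathrm{mhe}}_j=\hat x^{\delta\mathrm{mhe}}_{j+1}-f_\mathrm{a}(\hat x^{\delta\mathrm{mhe}}_j,u_j)$, $\hat z^{\delta\mathrm{mhe}}_j=(\hat x^{\delta\mathrm{mhe}}_j,\hat w^{\delta\mathrm{mhe}}_j)$ for $j\in\{\delta,\dots,t-\delta-1\}$, $\hat z^{\delta\mathrm{mhe}}_{t-\delta}=(\hat x^{\delta\mathrm{mhe}}_{t-\delta},0)$. Performance: $J_{[t_1,t_2]}(\hat z_{t_1:t_2})=\sum_{j=t_1}^{t_2-1}l(\hat z_j;d_j)$. *)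

theory Defs
  imports "HOL-Analysis.Analysis"
begin

text \<open>Weighted squared norm |x|_Q^2 = x' Q x.\<close>
definition qnorm2 :: "real^'k^'k \<Rightarrow> real^'k \<Rightarrow> real" where
  "qnorm2 Q x = x \<bullet> (Q *v x)"

text \<open>Positive definite matrix (symmetric, x' Q x > 0 for x \<noteq> 0).\<close>
definition pos_def :: "real^'k^'k \<Rightarrow> bool" where
  "pos_def Q \<longleftrightarrow> transpose Q = Q \<and> (\<forall>x. x \<noteq> 0 \<longrightarrow> qnorm2 Q x > 0)"

text \<open>Stage cost l(x,w;(u,y)) = |w|_Q^2 + |y - h(x,u)|_R^2.\<close>
definition stage_cost ::
  "real^'n^'n \<Rightarrow> real^'p^'p \<Rightarrow> (real^'n \<Rightarrow> real^'m \<Rightarrow> real^'p)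
   \<Rightarrow> (real^'n) \<times> (real^'n) \<Rightarrow> (real^'m) \<times> (real^'p) \<Rightarrow> real" where
  "stage_cost Q R h z d = qnorm2 Q (snd z) + qnorm2 R (snd d - h (fst z) (fst d))"

text \<open>Comparison function classes.\<close>
definition class_K :: "(real \<Rightarrow> real) \<Rightarrow> bool" where
  "class_K \<alpha> \<longleftrightarrow> continuous_on {0..} \<alpha> \<and> \<alpha> 0 = 0 \<and> strict_mono_on {0..} \<alpha>"

definition class_L :: "(real \<Rightarrow> real) \<Rightarrow> bool" where
  "class_L \<sigma> \<longleftrightarrow> continuous_on {0..} \<sigma> \<and> (\<forall>s\<ge>0. \<sigma> s \<ge> 0)
     \<and> (\<forall>s1 s2. 0 \<le> s1 \<longrightarrow> s1 \<le> s2 \<longrightarrow> \<sigma> s2 \<le> \<sigma> s1)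
     \<and> (\<sigma> \<longlongrightarrow> 0) at_top"

definition class_KL :: "(real \<Rightarrow> real \<Rightarrow> real) \<Rightarrow> bool" where
  "class_KL \<beta> \<longleftrightarrow> (\<forall>s\<ge>0. class_K (\<lambda>r. \<beta> r s))
     \<and> (\<forall>r\<ge>0. (\<forall>s1 s2. 0 \<le> s1 \<longrightarrow> s1 \<le> s2 \<longrightarrow> \<beta> r s2 \<le> \<beta> r s1)
               \<and> ((\<lambda>s. \<beta> r s) \<longlongrightarrow> 0) at_top)"

text \<open>Possible data sequences (d_t = (u_t, y_t), t \<in> \<int>) for
  x_{t+1} = f_a(x_t,u_t) + w_t, y_t = h(x_t,u_t) + v_t.\<close>
definition possible_data ::
  "(real^'n) set \<Rightarrow> (real^'m) set \<Rightarrow> (real^'n) set \<Rightarrow> (real^'p) set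
   \<Rightarrow> (real^'n \<Rightarrow> real^'m \<Rightarrow> real^'n) \<Rightarrow> (real^'n \<Rightarrow> real^'m \<Rightarrow> real^'p)
   \<Rightarrow> (int \<Rightarrow> (real^'m) \<times> (real^'p)) \<Rightarrow> bool" where
  "possible_data X U W V fa h d \<longleftrightarrow>
     (\<exists>x w v. \<forall>t. x t \<in> X \<and> fst (d t) \<in> U \<and> w t \<in> W \<and> v t \<in> V
        \<and> x (t + 1) = fa (x t) (fst (d t)) + w t
        \<and> snd (d t) = h (x t) (fst (d t)) + v t)"

text \<open>Feasible set of P_N for window data dw j = d_{a+j}, j = 0..N.\<close>
definition feasible_N ::
  "(real^'n) set \<Rightarrow> (real^'n) set \<Rightarrow> (real^'p) set
   \<Rightarrow> (real^'n \<Rightarrow> real^'m \<Rightarrow> real^'n) \<Rightarrow> (real^'n \<Rightarrow> real^'m \<Rightarrow> real^'p)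
   \<Rightarrow> nat \<Rightarrow> (nat \<Rightarrow> (real^'m) \<times> (real^'p)) \<Rightarrow> (nat \<Rightarrow> (real^'n) \<times> (real^'n)) \<Rightarrow> bool" where
  "feasible_N X W V fa h N dw z \<longleftrightarrow>
     (\<forall>j<N. fst (z (Suc j)) = fa (fst (z j)) (fst (dw j)) + snd (z j))
     \<and> (\<forall>j\<le>N. fst (z j) \<in> X) \<and> (\<forall>j<N. snd (z j) \<in> W)
     \<and> (\<forall>j\<le>N. snd (dw j) - h (fst (z j)) (fst (dw j)) \<in> V)"

text \<open>Cost of P_N.\<close>
definition cost_N ::
  "real^'n^'n \<Rightarrow> real^'p^'p \<Rightarrow> (real^'n \<Rightarrow> real^'m \<Rightarrow> real^'p)
   \<Rightarrow> (real^'n \<Rightarrow> (real^'m) \<times> (real^'p) \<Rightarrow> real)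
   \<Rightarrow> nat \<Rightarrow> (nat \<Rightarrow> (real^'m) \<times> (real^'p)) \<Rightarrow> (nat \<Rightarrow> (real^'n) \<times> (real^'n)) \<Rightarrow> real" where
  "cost_N Q R h g N dw z = (\<Sum>j<N. stage_cost Q R h (z j) (dw j)) + g (fst (z N)) (dw N)"

text \<open>zeta N dw is an optimal solution of P_N(dw), with the last entry (x_N, 0).\<close>
definition optimal_N where
  "optimal_N X W V fa h Q R g N dw z \<longleftrightarrow>
     feasible_N X W V fa h N dw z \<and> snd (z N) = 0 \<and>
     (\<forall>z'. feasible_N X W V fa h N dw z' \<longrightarrow> cost_N Q R h g N dw z \<le> cost_N Q R h g N dw z')"

text \<open>Feasible set and (extended nonnegative) cost of P_\<infinity>.\<close>
definition feasible_inf ::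
  "(real^'n) set \<Rightarrow> (real^'n) set \<Rightarrow> (real^'p) set
   \<Rightarrow> (real^'n \<Rightarrow> real^'m \<Rightarrow> real^'n) \<Rightarrow> (real^'n \<Rightarrow> real^'m \<Rightarrow> real^'p)
   \<Rightarrow> (int \<Rightarrow> (real^'m) \<times> (real^'p)) \<Rightarrow> (int \<Rightarrow> (real^'n) \<times> (real^'n)) \<Rightarrow> bool" where
  "feasible_inf X W V fa h d z \<longleftrightarrow>
     (\<forall>j. fst (z (j + 1)) = fa (fst (z j)) (fst (d j)) + snd (z j)
        \<and> fst (z j) \<in> X \<and> snd (z j) \<in> W
        \<and> snd (d j) - h (fst (z j)) (fst (d j)) \<in> V)"

definition cost_inf ::
  "real^'n^'n \<Rightarrow> real^'p^'p \<Rightarrow> (real^'n \<Rightarrow> real^'m \<Rightarrow> real^'p)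
   \<Rightarrow> (int \<Rightarrow> (real^'m) \<times> (real^'p)) \<Rightarrow> (int \<Rightarrow> (real^'n) \<times> (real^'n)) \<Rightarrow> ennreal" where
  "cost_inf Q R h d z = (\<Sum>\<^sub>\<infinity>j\<in>(UNIV::int set). ennreal (stage_cost Q R h (z j) (d j)))"

text \<open>zinf is the unique solution of P_\<infinity>(d).\<close>
definition unique_opt_inf where
  "unique_opt_inf X W V fa h Q R d z \<longleftrightarrow>
     feasible_inf X W V fa h d z \<and>
     (\<forall>z'. feasible_inf X W V fa h d z' \<longrightarrow> cost_inf Q R h d z \<le> cost_inf Q R h d z')
     \<and> (\<forall>z'. feasible_inf X W V fa h d z' \<longrightarrow> cost_inf Q R h d z' \<le> cost_inf Q R h d z \<longrightarrow> z' = z)"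

text \<open>The window d_{a:a+N} as a function j \<mapsto> d_{a+j}.\<close>
definition window :: "(int \<Rightarrow> 'a) \<Rightarrow> int \<Rightarrow> nat \<Rightarrow> 'a" where
  "window d a = (\<lambda>j. d (a + int j))"

text \<open>delta-MHE state estimate of x_s (s = t - \<delta>), computed at time t = s + \<delta>.\<close>
definition mhe_x where
  "mhe_x zeta N \<delta> d s =
     (if N \<le> s + \<delta> then fst (zeta N (window d (int (s + \<delta>) - int N)) (N - \<delta>))
      else fst (zeta (s + \<delta>) (window d 0) s))"

text \<open>delta-MHE sequence z^{\<delta>mhe}_j for fixed t, j \<in> {\<delta>..t-\<delta>}.\<close>
definition mhe_z where
  "mhe_z fa zeta N \<delta> t d j =
     (if j < t - \<delta>
      then (mhe_x zeta N \<delta> d j, mhe_x zeta N \<delta> d (Suc j) - fa (mhe_x zeta N \<delta> d j) (fst (d (int j))))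
      else (mhe_x zeta N \<delta> d j, 0))"

text \<open>Performance J_{[t1,t2]}.\<close>
definition perf_J where
  "perf_J Q R h d t1 t2 z = (\<Sum>j\<in>{t1..<t2}. stage_cost Q R h (z j) (d j))"

end

theory Submission
  imports Defs
begin

text \<open>Along a window of the \<delta>MHE, the estimate of \<open>x\<^sub>s\<close> is the state of an optimal
  finite-horizon solution at least \<open>\<delta>\<close> steps away from both ends of its window, so by the
  turnpike property it lies within \<open>2 \<beta>(D, \<delta>)\<close> of \<open>x\<^sup>\<infinity>\<^sub>s\<close>, where \<open>D\<close> is the diameter of
  \<open>X \<times> W\<close>. Lipschitz continuity of \<open>f\<^sub>a\<close> and \<open>h\<close> turns this into an \<open>O(\<beta>(D, \<delta>))\<close> bound on
  the residuals of the estimated sequence relative to those of \<open>z\<^sup>\<infinity>\<close>, and the inequality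
  \<open>|b + c|\<^sub>Q\<^sup>2 \<le> (1 + \<epsilon>) |b|\<^sub>Q\<^sup>2 + (1 + \<epsilon>)/\<epsilon> |c|\<^sub>Q\<^sup>2\<close> bounds each stage cost difference by
  \<open>\<epsilon> A + (1 + \<epsilon>)/\<epsilon> \<sigma>(\<delta>)\<close>. Since a class \<open>\<K>\<L>\<close> function need not be continuous in its
  second argument, \<open>\<sigma>\<close> is the piecewise linear interpolation of \<open>\<delta> \<mapsto> \<beta>(D, \<delta>)\<^sup>2\<close>.\<close>

section \<open>Class \<open>\<L>\<close> functions from decreasing sequences\<close>

text \<open>For \<open>s < 0\<close> this is the affine extension of the first segment, which makes
  \<open>0\<close> an interior point of the domain of continuity.\<close>
definition lin_interp :: "(nat \<Rightarrow> real) \<Rightarrow> real \<Rightarrow> real" where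
  "lin_interp c s =
     c (nat \<lfloor>s\<rfloor>) + (s - real (nat \<lfloor>s\<rfloor>)) * (c (Suc (nat \<lfloor>s\<rfloor>)) - c (nat \<lfloor>s\<rfloor>))"

lemma lin_interp_of_nat [simp]: "lin_interp c (real k) = c k"
  by (simp add: lin_interp_def)

lemma lin_interp_segment:
  assumes "real n \<le> s" "s \<le> real n + 1"
  shows "lin_interp c s = c n + (s - real n) * (c (Suc n) - c n)"
proof (cases "s = real n + 1")
  case True
  then show ?thesis
    using lin_interp_of_nat[of c "Suc n"] by (simp add: algebra_simps)
next
  case False
  with assms have "nat \<lfloor>s\<rfloor> = n" by linarith
  then show ?thesis by (simp add: lin_interp_def)
qed

lemma continuous_on_lin_interp: "continuous_on {0..} (lin_interp c)"
proof -
  have "continuous_on {-1..real n} (lin_interp c)" for n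
  proof (induction n)
    case 0
    have "lin_interp c s = c 0 + s * (c 1 - c 0)" if "s \<in> {-1..0}" for s
      using that lin_interp_segment[of 0 s c] by (cases "s < 0") (auto simp: lin_interp_def)
    then show ?case
      by (subst continuous_on_cong[OF refl]) (auto intro!: continuous_intros)
  next
    case (Suc n)
    have "continuous_on {real n..real n + 1} (lin_interp c)"
      using lin_interp_segment[of n _ c]
      by (subst continuous_on_cong[OF refl]) (auto intro!: continuous_intros)
    with Suc.IH have "continuous_on ({-1..real n} \<union> {real n..real n + 1}) (lin_interp c)"
      by (intro continuous_on_closed_Un) auto
    moreover have "{-1..real n} \<union> {real n..real n + 1} = {-1..real (Suc n)}" by auto
    ultimately show ?case by simp
  qed
  moreover have "\<exists>n. s \<in> interior {-1..real n}" if "s \<ge> 0" for s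
    using that reals_Archimedean2[of s] by auto
  ultimately show ?thesis
    by (meson atLeast_iff continuous_at_imp_continuous_on continuous_on_interior)
qed

lemma lin_interp_bounds:
  assumes "decseq c" "s \<ge> 0"
  shows "c (Suc (nat \<lfloor>s\<rfloor>)) \<le> lin_interp c s" "lin_interp c s \<le> c (nat \<lfloor>s\<rfloor>)"
proof -
  let ?n = "nat \<lfloor>s\<rfloor>"
  have frac: "0 \<le> s - real ?n" "s - real ?n \<le> 1" using assms(2) by linarith+
  have step: "c (Suc ?n) - c ?n \<le> 0" using assms(1) by (simp add: decseq_SucD)
  have "c (Suc ?n) - c ?n \<le> (s - real ?n) * (c (Suc ?n) - c ?n)"
    using mult_right_mono_neg[OF frac(2) step] by simp
  then show "c (Suc ?n) \<le> lin_interp c s"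
    unfolding lin_interp_def by linarith
  have "(s - real ?n) * (c (Suc ?n) - c ?n) \<le> 0"
    by (rule mult_nonneg_nonpos[OF frac(1) step])
  then show "lin_interp c s \<le> c ?n"
    unfolding lin_interp_def by linarith
qed

lemma lin_interp_antimono:
  assumes "decseq c" "0 \<le> s1" "s1 \<le> s2"
  shows "lin_interp c s2 \<le> lin_interp c s1"
proof (cases "nat \<lfloor>s1\<rfloor> = nat \<lfloor>s2\<rfloor>")
  case True
  let ?n = "nat \<lfloor>s1\<rfloor>"
  have "c (Suc ?n) \<le> c ?n" using assms(1) by (simp add: decseq_SucD)
  then have "(s2 - real ?n) * (c (Suc ?n) - c ?n) \<le> (s1 - real ?n) * (c (Suc ?n) - c ?n)"
    using assms(3) by (intro mult_right_mono_neg) auto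
  then show ?thesis using True by (simp add: lin_interp_def)
next
  case False
  then have "Suc (nat \<lfloor>s1\<rfloor>) \<le> nat \<lfloor>s2\<rfloor>"
    using nat_mono[OF floor_mono[OF assms(3)]] by linarith
  then have "c (nat \<lfloor>s2\<rfloor>) \<le> c (Suc (nat \<lfloor>s1\<rfloor>))" using assms(1) by (simp add: decseq_def)
  then show ?thesis using lin_interp_bounds[OF assms(1)] assms(2,3) by (meson order_trans)
qed

lemma class_L_lin_interp:
  assumes dec: "decseq c" and nonneg: "\<And>k. 0 \<le> c k" and lim: "c \<longlonglongrightarrow> 0"
  shows "class_L (lin_interp c)"
proof -
  have lin_nonneg: "0 \<le> lin_interp c s" if "s \<ge> 0" for s
    using lin_interp_bounds(1)[OF dec that] nonneg order_trans by blast
  have "filterlim (\<lambda>s::real. nat \<lfloor>s\<rfloor>) sequentially at_top"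
    by (intro filterlim_compose[OF filterlim_nat_sequentially]
          filterlim_compose[OF filterlim_floor_sequentially] filterlim_ident)
  from filterlim_compose[OF lim this]
  have upper_lim: "((\<lambda>s::real. c (nat \<lfloor>s\<rfloor>)) \<longlongrightarrow> 0) at_top"
    by simp
  have "\<forall>\<^sub>F s in at_top. 0 \<le> lin_interp c s"
    using lin_nonneg by (rule eventually_at_top_linorderI)
  moreover have "\<forall>\<^sub>F s in at_top. lin_interp c s \<le> c (nat \<lfloor>s\<rfloor>)"
    using lin_interp_bounds(2)[OF dec] by (rule eventually_at_top_linorderI)
  ultimately have "(lin_interp c \<longlongrightarrow> 0) at_top"
    using tendsto_sandwich[OF _ _ tendsto_const upper_lim] by blast
  then show ?thesis
    unfolding class_L_def
    using continuous_on_lin_interp lin_nonneg lin_interp_antimono[OF dec] by blast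
qed

section \<open>Weighted squared norms\<close>

lemma symmetric_matrix_inner_commute:
  fixes Q :: "real^'n^'n"
  assumes "transpose Q = Q"
  shows "b \<bullet> (Q *v c) = c \<bullet> (Q *v b)"
proof -
  have "b \<bullet> (Q *v c) = (b v* Q) \<bullet> c" by (rule dot_lmul_matrix[symmetric])
  also have "b v* Q = Q *v b" using vector_transpose_matrix[of b Q] assms by simp
  finally show ?thesis by (simp add: inner_commute)
qed

lemma qnorm2_nonneg: "pos_def Q \<Longrightarrow> 0 \<le> qnorm2 Q x"
  unfolding pos_def_def by (cases "x = 0") (auto simp: qnorm2_def intro: less_imp_le)

lemma qnorm2_add:
  assumes "transpose Q = Q"
  shows "qnorm2 Q (b + c) = qnorm2 Q b + 2 * (b \<bullet> (Q *v c)) + qnorm2 Q c"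
  using symmetric_matrix_inner_commute[OF assms, of b c]
  by (simp add: qnorm2_def matrix_vector_right_distrib inner_add_left inner_add_right)

lemma qnorm2_add_le:
  assumes Q: "pos_def Q" and \<epsilon>: "\<epsilon> > 0"
  shows "qnorm2 Q (b + c) \<le> (1 + \<epsilon>) * qnorm2 Q b + (1 + \<epsilon>) / \<epsilon> * qnorm2 Q c"
proof -
  have sym: "transpose Q = Q" using Q by (simp add: pos_def_def)
  have "0 \<le> qnorm2 Q (\<epsilon> *\<^sub>R b - c)" by (rule qnorm2_nonneg[OF Q])
  also have "\<dots> = \<epsilon>\<^sup>2 * qnorm2 Q b - 2 * \<epsilon> * (b \<bullet> (Q *v c)) + qnorm2 Q c"
    using qnorm2_add[OF sym, of "\<epsilon> *\<^sub>R b" "- c"]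
    by (simp add: qnorm2_def matrix_vector_mult_scaleR power2_eq_square
        matrix_vector_mult_diff_distrib[of Q 0 c, simplified])
  finally have "\<epsilon> * (2 * (b \<bullet> (Q *v c))) \<le> \<epsilon> * (\<epsilon> * qnorm2 Q b + qnorm2 Q c / \<epsilon>)"
    using \<epsilon> by (simp add: algebra_simps power2_eq_square)
  then have "2 * (b \<bullet> (Q *v c)) \<le> \<epsilon> * qnorm2 Q b + qnorm2 Q c / \<epsilon>"
    using \<epsilon> by (simp add: mult_le_cancel_left_pos)
  moreover have "(1 + \<epsilon>) / \<epsilon> = 1 + 1 / \<epsilon>" using \<epsilon> by (simp add: field_simps)
  ultimately show ?thesis
    using qnorm2_add[OF sym, of b c] by (simp add: algebra_simps)
qed

lemma qnorm2_le_onorm: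
  assumes "norm x \<le> B"
  shows "qnorm2 Q x \<le> onorm ((*v) Q) * B\<^sup>2"
proof -
  have "qnorm2 Q x \<le> norm x * norm (Q *v x)"
    unfolding qnorm2_def by (rule norm_cauchy_schwarz)
  also have "\<dots> \<le> norm x * (onorm ((*v) Q) * norm x)"
    by (intro mult_left_mono onorm) auto
  also have "\<dots> \<le> onorm ((*v) Q) * B\<^sup>2"
    using assms onorm_pos_le[OF matrix_vector_mul_bounded_linear[of Q]]
    by (simp add: power2_eq_square mult_mono' algebra_simps mult_left_mono)
  finally show ?thesis .
qed

section \<open>Stage costs\<close>

lemma stage_cost_diff_le:
  assumes "pos_def Q" "pos_def R" "\<epsilon> > 0"
  shows "stage_cost Q R h (x, w) (u, y) - stage_cost Q R h (x', w') (u, y)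
    \<le> \<epsilon> * stage_cost Q R h (x', w') (u, y)
       + (1 + \<epsilon>) / \<epsilon> * (qnorm2 Q (w - w') + qnorm2 R (h x' u - h x u))"
  using qnorm2_add_le[OF assms(1,3), of w' "w - w'"]
    qnorm2_add_le[OF assms(2,3), of "y - h x' u" "h x' u - h x u"]
  by (simp add: stage_cost_def algebra_simps)

lemma stage_cost_estimate_diff_le:
  assumes "pos_def Q" "pos_def R" "\<epsilon> > 0"
    and lip_fa: "Lf-lipschitz_on X (\<lambda>x. fa x u)" and lip_h: "Lh-lipschitz_on X (\<lambda>x. h x u)"
    and "x \<in> X" "xi \<in> X" and close: "norm (x - xi) \<le> e" "norm (x' - (fa xi u + wi)) \<le> e"
  shows "stage_cost Q R h (x, x' - fa x u) (u, y) - stage_cost Q R h (xi, wi) (u, y)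
    \<le> \<epsilon> * stage_cost Q R h (xi, wi) (u, y)
       + (1 + \<epsilon>) / \<epsilon> * (onorm ((*v) Q) * ((1 + Lf) * e)\<^sup>2 + onorm ((*v) R) * (Lh * e)\<^sup>2)"
proof -
  have "norm (fa x u - fa xi u) \<le> Lf * e"
    using lipschitz_on_normD[OF lip_fa \<open>x \<in> X\<close> \<open>xi \<in> X\<close>] lipschitz_on_nonneg[OF lip_fa] close(1)
    by (meson mult_left_mono order_trans)
  then have "norm ((x' - fa x u) - wi) \<le> (1 + Lf) * e"
    using norm_triangle_ineq4[of "x' - (fa xi u + wi)" "fa x u - fa xi u"] close(2)
    by (simp add: algebra_simps)
  moreover have "norm (h xi u - h x u) \<le> Lh * e"
    using lipschitz_on_normD[OF lip_h \<open>xi \<in> X\<close> \<open>x \<in> X\<close>] lipschitz_on_nonneg[OF lip_h] close(1)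
    by (metis mult_left_mono norm_minus_commute order_trans)
  ultimately have "qnorm2 Q ((x' - fa x u) - wi) + qnorm2 R (h xi u - h x u)
      \<le> onorm ((*v) Q) * ((1 + Lf) * e)\<^sup>2 + onorm ((*v) R) * (Lh * e)\<^sup>2"
    by (intro add_mono qnorm2_le_onorm)
  then have "(1 + \<epsilon>) / \<epsilon> * (qnorm2 Q ((x' - fa x u) - wi) + qnorm2 R (h xi u - h x u))
      \<le> (1 + \<epsilon>) / \<epsilon> * (onorm ((*v) Q) * ((1 + Lf) * e)\<^sup>2 + onorm ((*v) R) * (Lh * e)\<^sup>2)"
    using \<open>\<epsilon> > 0\<close> by (intro mult_left_mono) auto
  then show ?thesis
    using stage_cost_diff_le[OF assms(1-3), of h x "x' - fa x u" u y xi wi] by linarith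
qed

lemma perf_J_diff_le:
  assumes "\<And>j. t1 \<le> j \<Longrightarrow> j < t2 \<Longrightarrow>
    stage_cost Q R h (z j) (d j) - stage_cost Q R h (z' j) (d j) \<le> b"
  shows "perf_J Q R h d t1 t2 z - perf_J Q R h d t1 t2 z' \<le> real (t2 - t1) * b"
proof -
  have "perf_J Q R h d t1 t2 z - perf_J Q R h d t1 t2 z'
      = (\<Sum>j\<in>{t1..<t2}. stage_cost Q R h (z j) (d j) - stage_cost Q R h (z' j) (d j))"
    unfolding perf_J_def by (simp add: sum_subtractf)
  also have "\<dots> \<le> real (card {t1..<t2}) * b"
    using assms by (intro sum_bounded_above) auto
  finally show ?thesis by simp
qed

section \<open>Turnpike estimates for the \<open>\<delta>\<close>MHE\<close>

lemma class_KL_mono: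
  assumes "class_KL \<beta>" "0 \<le> r" "r \<le> r'" "0 \<le> s'" "s' \<le> s"
  shows "\<beta> r s \<le> \<beta> r' s'"
proof -
  have "strict_mono_on {0..} (\<lambda>r. \<beta> r s)"
    using assms unfolding class_KL_def class_K_def by auto
  then have "\<beta> r s < \<beta> r' s" if "r < r'"
    using assms(2) that by (auto intro: strict_mono_onD)
  then have "\<beta> r s \<le> \<beta> r' s"
    using assms(3) by (cases "r = r'") auto
  also have "\<dots> \<le> \<beta> r' s'"
    using assms unfolding class_KL_def by auto
  finally show ?thesis .
qed

lemma class_KL_nonneg:
  assumes "class_KL \<beta>" "0 \<le> r" "0 \<le> s"
  shows "0 \<le> \<beta> r s"
proof -
  have "\<beta> 0 s = 0" using assms unfolding class_KL_def class_K_def by auto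
  then show ?thesis using class_KL_mono[OF assms(1) order_refl assms(2) assms(3) order_refl] by simp
qed

lemma class_L_lin_interp_class_KL:
  assumes "class_KL \<beta>" "0 \<le> r" "0 \<le> K"
  shows "class_L (lin_interp (\<lambda>k. K * (\<beta> r (real k))\<^sup>2))"
proof (rule class_L_lin_interp)
  have "\<beta> r (real n) \<le> \<beta> r (real m)" if "m \<le> n" for m n
    using class_KL_mono[OF assms(1,2) order_refl] that by simp
  then show "decseq (\<lambda>k. K * (\<beta> r (real k))\<^sup>2)"
    using assms class_KL_nonneg[OF assms(1,2)]
    by (auto simp: decseq_def intro!: mult_left_mono power_mono)
  have "((\<lambda>s. \<beta> r s) \<longlongrightarrow> 0) at_top"
    using assms unfolding class_KL_def by auto
  from filterlim_compose[OF this filterlim_real_sequentially]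
  show "(\<lambda>k. K * (\<beta> r (real k))\<^sup>2) \<longlonglongrightarrow> 0"
    by (auto intro: tendsto_eq_intros)
qed (use assms in simp)

lemma optimal_N_mem_Times:
  assumes "optimal_N X W V fa h Q R g N dw z" "0 \<in> W" "j \<le> N"
  shows "z j \<in> X \<times> W"
  using assms by (cases "j = N") (auto simp: optimal_N_def feasible_N_def mem_Times_iff)

lemma feasible_inf_mem_Times: "feasible_inf X W V fa h d z \<Longrightarrow> z i \<in> X \<times> W"
  by (simp add: feasible_inf_def mem_Times_iff)

lemma feasible_inf_stage_cost_le:
  assumes "feasible_inf X W V fa h d z" "\<forall>w\<in>W. norm w \<le> MW" "\<forall>v\<in>V. norm v \<le> MV"
  shows "stage_cost Q R h (z i) (d i) \<le> onorm ((*v) Q) * MW\<^sup>2 + onorm ((*v) R) * MV\<^sup>2"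
  using assms unfolding feasible_inf_def stage_cost_def by (blast intro: add_mono qnorm2_le_onorm)

lemma mhe_x_lagged_zeta:
  assumes "2 * \<delta> \<le> N" "\<delta> \<le> s"
  obtains a j where "mhe_x zeta N \<delta> d s = fst (zeta (j + \<delta>) (window d a) j)"
    "a + int j = int s" "\<delta> \<le> j"
proof (cases "N \<le> s + \<delta>")
  case True
  with assms show ?thesis
    by (intro that[of "N - \<delta>" "int (s + \<delta>) - int N"]) (auto simp: mhe_x_def)
next
  case False
  with assms show ?thesis
    by (intro that[of s 0]) (auto simp: mhe_x_def)
qed

lemma mhe_x_turnpike_close:
  assumes KL: "class_KL \<beta>"
    and turnpike: "\<And>N a j. j \<le> N \<Longrightarrow> norm (zeta N (window d a) j - zinf (a + int j))
          \<le> \<beta> (norm (zeta N (window d a) 0 - zinf a)) (real j)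
           + \<beta> (norm (zeta N (window d a) N - zinf (a + int N))) (real (N - j))"
    and "bounded (X \<times> W)"
    and zeta_mem: "\<And>N a j. j \<le> N \<Longrightarrow> zeta N (window d a) j \<in> X \<times> W"
    and zinf_mem: "\<And>i. zinf i \<in> X \<times> W"
    and "2 * \<delta> \<le> N" "\<delta> \<le> s"
  shows "mhe_x zeta N \<delta> d s \<in> X"
    "norm (mhe_x zeta N \<delta> d s - fst (zinf (int s))) \<le> 2 * \<beta> (diameter (X \<times> W)) (real \<delta>)"
proof -
  obtain a j where mhe: "mhe_x zeta N \<delta> d s = fst (zeta (j + \<delta>) (window d a) j)"
    and s: "a + int j = int s" and "\<delta> \<le> j"
    using mhe_x_lagged_zeta[OF assms(6,7)] .
  let ?z = "zeta (j + \<delta>) (window d a)" and ?D = "diameter (X \<times> W)"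
  show "mhe_x zeta N \<delta> d s \<in> X"
    using mhe zeta_mem[of j "j + \<delta>" a] by (simp add: mem_Times_iff)
  have diam: "norm (?z k - zinf i) \<le> ?D" if "k \<le> j + \<delta>" for k i
    using diameter_bounded_bound[OF \<open>bounded (X \<times> W)\<close> zeta_mem[OF that] zinf_mem]
    by (simp add: dist_norm)
  then have "\<beta> (norm (?z 0 - zinf a)) (real j) \<le> \<beta> ?D (real \<delta>)"
    "\<beta> (norm (?z (j + \<delta>) - zinf (a + int (j + \<delta>)))) (real (j + \<delta> - j)) \<le> \<beta> ?D (real \<delta>)"
    using \<open>\<delta> \<le> j\<close> by (auto intro!: class_KL_mono[OF KL])
  then have "norm (?z j - zinf (int s)) \<le> 2 * \<beta> ?D (real \<delta>)"
    using turnpike[of j "j + \<delta>" a] s by simp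
  moreover have "norm (fst (?z j - zinf (int s))) \<le> norm (?z j - zinf (int s))"
    using norm_fst_le[of "fst (?z j - zinf (int s))" "snd (?z j - zinf (int s))"]
    by (simp only: prod.collapse)
  ultimately show "norm (mhe_x zeta N \<delta> d s - fst (zinf (int s))) \<le> 2 * \<beta> ?D (real \<delta>)"
    using mhe by (simp add: fst_diff)
qed

lemma mhe_perf_J_diff_le:
  assumes "pos_def Q" "pos_def R" "\<epsilon> > 0"
    and lip_fa: "\<And>u. u \<in> U \<Longrightarrow> Lf-lipschitz_on X (\<lambda>x. fa x u)"
    and lip_h: "\<And>u. u \<in> U \<Longrightarrow> Lh-lipschitz_on X (\<lambda>x. h x u)"
    and U: "\<And>i. fst (d i) \<in> U"
    and feasible: "feasible_inf X W V fa h d zinf"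
    and cost: "\<And>i. stage_cost Q R h (zinf i) (d i) \<le> A"
    and mhe_mem: "\<And>s. \<delta> \<le> s \<Longrightarrow> mhe_x zeta N \<delta> d s \<in> X"
    and mhe_close: "\<And>s. \<delta> \<le> s \<Longrightarrow> norm (mhe_x zeta N \<delta> d s - fst (zinf (int s))) \<le> e"
    and "\<delta> \<le> t1" "t2 \<le> t - \<delta>"
  shows "perf_J Q R h (\<lambda>j. d (int j)) t1 t2 (mhe_z fa zeta N \<delta> t d)
      - perf_J Q R h (\<lambda>j. d (int j)) t1 t2 (\<lambda>j. zinf (int j))
    \<le> real (t2 - t1) * (\<epsilon> * A
        + (1 + \<epsilon>) / \<epsilon> * (onorm ((*v) Q) * ((1 + Lf) * e)\<^sup>2 + onorm ((*v) R) * (Lh * e)\<^sup>2))"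
proof (rule perf_J_diff_le)
  fix j assume "t1 \<le> j" "j < t2"
  with \<open>\<delta> \<le> t1\<close> have "\<delta> \<le> j" by simp
  obtain u y where d: "d (int j) = (u, y)" by fastforce
  obtain xi wi where z: "zinf (int j) = (xi, wi)" by fastforce
  let ?x = "mhe_x zeta N \<delta> d"
  have mhe_z: "mhe_z fa zeta N \<delta> t d j = (?x j, ?x (Suc j) - fa (?x j) u)"
    using \<open>j < t2\<close> \<open>t2 \<le> t - \<delta>\<close> d by (simp add: mhe_z_def)
  have "fst (zinf (int j + 1)) = fa (fst (zinf (int j))) (fst (d (int j))) + snd (zinf (int j))"
    and "fst (zinf (int j)) \<in> X"
    using feasible unfolding feasible_inf_def by blast+
  then have next_state: "fst (zinf (int (Suc j))) = fa xi u + wi" and "xi \<in> X"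
    unfolding d z of_nat_Suc by (simp_all add: add.commute)
  have "u \<in> U" using U[of "int j"] d by simp
  have close: "norm (?x j - xi) \<le> e" "norm (?x (Suc j) - (fa xi u + wi)) \<le> e"
    using mhe_close[of j] mhe_close[of "Suc j"] \<open>\<delta> \<le> j\<close> z next_state by auto
  have "stage_cost Q R h (xi, wi) (u, y) \<le> A" using cost[of "int j"] unfolding d z .
  then have "\<epsilon> * stage_cost Q R h (xi, wi) (u, y) \<le> \<epsilon> * A"
    using \<open>\<epsilon> > 0\<close> by (intro mult_left_mono) auto
  with stage_cost_estimate_diff_le[where fa = fa and h = h and u = u, OF assms(1-3) lip_fa[OF \<open>u \<in> U\<close>] lip_h[OF \<open>u \<in> U\<close>]
      mhe_mem[OF \<open>\<delta> \<le> j\<close>] \<open>xi \<in> X\<close> close, of y]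
  show "stage_cost Q R h (mhe_z fa zeta N \<delta> t d j) (d (int j))
      - stage_cost Q R h (zinf (int j)) (d (int j))
    \<le> \<epsilon> * A + (1 + \<epsilon>) / \<epsilon> * (onorm ((*v) Q) * ((1 + Lf) * e)\<^sup>2 + onorm ((*v) R) * (Lh * e)\<^sup>2)"
    unfolding mhe_z d z by linarith
qed


theorem corollary1:
  fixes X W :: "(real^'n) set" and U :: "(real^'m) set" and V :: "(real^'p) set"
    and fa :: "real^'n \<Rightarrow> real^'m \<Rightarrow> real^'n"
    and h :: "real^'n \<Rightarrow> real^'m \<Rightarrow> real^'p"
    and Q :: "real^'n^'n" and R :: "real^'p^'p"
    and g :: "real^'n \<Rightarrow> (real^'m) \<times> (real^'p) \<Rightarrow> real"
    and zeta :: "nat \<Rightarrow> (nat \<Rightarrow> (real^'m) \<times> (real^'p)) \<Rightarrow> nat \<Rightarrow> (real^'n) \<times> (real^'n)"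
    and zinf :: "(int \<Rightarrow> (real^'m) \<times> (real^'p)) \<Rightarrow> int \<Rightarrow> (real^'n) \<times> (real^'n)"
  assumes cont_fa: "continuous_on (X \<times> U) (\<lambda>(x, u). fa x u)"
    and cont_h: "continuous_on (X \<times> U) (\<lambda>(x, u). h x u)"
    and invariant: "\<forall>x\<in>X. \<forall>u\<in>U. \<forall>w\<in>W. fa x u + w \<in> X"
    and W0: "0 \<in> W"
    and compX: "compact X" and compW: "compact W" and compV: "compact V"
    and Qpd: "pos_def Q" and Rpd: "pos_def R"
    and g_nonneg: "\<forall>x d. g x d \<ge> 0"
    and g_cont: "\<forall>d. continuous_on UNIV (\<lambda>x. g x d)"
    and zeta_opt: "\<forall>d N a. possible_data X U W V fa h d \<longrightarrow>
                     optimal_N X W V fa h Q R g N (window d a) (zeta N (window d a))"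
    and zinf_opt: "\<forall>d. possible_data X U W V fa h d \<longrightarrow> unique_opt_inf X W V fa h Q R d (zinf d)"
    and turnpike: "\<exists>\<beta>. class_KL \<beta> \<and>
       (\<forall>d N a j. possible_data X U W V fa h d \<longrightarrow> j \<le> N \<longrightarrow>
          norm (zeta N (window d a) j - zinf d (a + int j))
            \<le> \<beta> (norm (zeta N (window d a) 0 - zinf d a)) (real j)
             + \<beta> (norm (zeta N (window d a) N - zinf d (a + int N))) (real (N - j)))"
    and lip_fa: "\<exists>L. \<forall>u\<in>U. L-lipschitz_on X (\<lambda>x. fa x u)"
    and lip_h: "\<exists>L. \<forall>u\<in>U. L-lipschitz_on X (\<lambda>x. h x u)"
  shows "\<exists>A > 0. \<exists>\<sigma>. class_L \<sigma> \<and>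
    (\<forall>\<epsilon>>0. \<forall>N \<delta> t t1 t2 d. even N \<longrightarrow> \<delta> \<le> N div 2 \<longrightarrow> \<delta> \<le> t \<longrightarrow>
        \<delta> \<le> t1 \<longrightarrow> t1 \<le> t2 \<longrightarrow> t2 \<le> t - \<delta> \<longrightarrow> possible_data X U W V fa h d \<longrightarrow>
        perf_J Q R h (\<lambda>j. d (int j)) t1 t2 (mhe_z fa zeta N \<delta> t d)
          - perf_J Q R h (\<lambda>j. d (int j)) t1 t2 (\<lambda>j. zinf d (int j))
        \<le> real (t2 - t1) * (\<epsilon> * A + (1 + \<epsilon>) / \<epsilon> * \<sigma> (real \<delta>)))"
proof -
  \<comment> \<open>Continuity, the invariance of \<open>X\<close> and the terminal cost \<open>g\<close> only serve the existence of
    the optimal solutions \<open>zeta\<close> and \<open>zinf\<close>, which is assumed outright.\<close>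
  obtain \<beta> where KL: "class_KL \<beta>" and turnpike_ineq: "\<And>d N a j. possible_data X U W V fa h d \<Longrightarrow>
      j \<le> N \<Longrightarrow> norm (zeta N (window d a) j - zinf d (a + int j))
        \<le> \<beta> (norm (zeta N (window d a) 0 - zinf d a)) (real j)
         + \<beta> (norm (zeta N (window d a) N - zinf d (a + int N))) (real (N - j))"
    using turnpike by blast
  obtain Lf Lh where lip: "\<forall>u\<in>U. Lf-lipschitz_on X (\<lambda>x. fa x u)" "\<forall>u\<in>U. Lh-lipschitz_on X (\<lambda>x. h x u)"
    using lip_fa lip_h by blast
  obtain MW MV where bounds: "\<forall>w\<in>W. norm w \<le> MW" "\<forall>v\<in>V. norm v \<le> MV"
    using compW compV by (meson bounded_iff compact_imp_bounded)
  have bounded: "bounded (X \<times> W)"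
    using compX compW by (simp add: compact_Times compact_imp_bounded)
  have onorm_nonneg: "0 \<le> onorm ((*v) Q)" "0 \<le> onorm ((*v) R)"
    by (simp_all add: onorm_pos_le)
  define D where "D = diameter (X \<times> W)"
  define A where "A = onorm ((*v) Q) * MW\<^sup>2 + onorm ((*v) R) * MV\<^sup>2 + 1"
  define K where "K = 4 * (onorm ((*v) Q) * (1 + Lf)\<^sup>2 + onorm ((*v) R) * Lh\<^sup>2)"
  define \<sigma> where "\<sigma> = lin_interp (\<lambda>k. K * (\<beta> D (real k))\<^sup>2)"
  have A_pos: "A > 0" unfolding A_def using onorm_nonneg by (simp add: add_nonneg_pos)
  have \<sigma>_class_L: "class_L \<sigma>"
    unfolding \<sigma>_def K_def D_def using KL diameter_ge_0[OF bounded] onorm_nonneg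
    by (intro class_L_lin_interp_class_KL) auto
  have performance: "perf_J Q R h (\<lambda>j. d (int j)) t1 t2 (mhe_z fa zeta N \<delta> t d)
          - perf_J Q R h (\<lambda>j. d (int j)) t1 t2 (\<lambda>j. zinf d (int j))
        \<le> real (t2 - t1) * (\<epsilon> * A + (1 + \<epsilon>) / \<epsilon> * \<sigma> (real \<delta>))"
    if "\<epsilon> > 0" "\<delta> \<le> N div 2" "\<delta> \<le> t1" "t2 \<le> t - \<delta>" and data: "possible_data X U W V fa h d"
    for \<epsilon> N \<delta> t t1 t2 d
  proof -
    have feasible: "feasible_inf X W V fa h d (zinf d)"
      using zinf_opt data by (simp add: unique_opt_inf_def)
    have "2 * \<delta> \<le> N" using \<open>\<delta> \<le> N div 2\<close> by simp
    note close = mhe_x_turnpike_close[where zeta = zeta and zinf = "zinf d" and d = d,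
        OF KL turnpike_ineq[OF data] bounded
        optimal_N_mem_Times[OF zeta_opt[rule_format, OF data] W0]
        feasible_inf_mem_Times[OF feasible] \<open>2 * \<delta> \<le> N\<close>, folded D_def]
    have cost: "stage_cost Q R h (zinf d i) (d i) \<le> A" for i
      using feasible_inf_stage_cost_le[OF feasible bounds, where Q=Q and R=R and i=i]
      unfolding A_def by linarith
    have U: "fst (d i) \<in> U" for i
      using data unfolding possible_data_def by blast
    have \<sigma>_eq: "onorm ((*v) Q) * ((1 + Lf) * (2 * \<beta> D (real \<delta>)))\<^sup>2
        + onorm ((*v) R) * (Lh * (2 * \<beta> D (real \<delta>)))\<^sup>2 = \<sigma> (real \<delta>)"
      unfolding \<sigma>_def K_def lin_interp_of_nat
      by (simp only: power_mult_distrib) (simp add: algebra_simps)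
    have "perf_J Q R h (\<lambda>j. d (int j)) t1 t2 (mhe_z fa zeta N \<delta> t d)
          - perf_J Q R h (\<lambda>j. d (int j)) t1 t2 (\<lambda>j. zinf d (int j))
        \<le> real (t2 - t1) * (\<epsilon> * A + (1 + \<epsilon>) / \<epsilon> * (onorm ((*v) Q) * ((1 + Lf) * (2 * \<beta> D (real \<delta>)))\<^sup>2
            + onorm ((*v) R) * (Lh * (2 * \<beta> D (real \<delta>)))\<^sup>2))"
      by (rule mhe_perf_J_diff_le[OF Qpd Rpd \<open>\<epsilon> > 0\<close> lip[rule_format] U feasible cost close
            \<open>\<delta> \<le> t1\<close> \<open>t2 \<le> t - \<delta>\<close>])
    then show ?thesis unfolding \<sigma>_eq .
  qed
  show ?thesis
    using A_pos \<sigma>_class_L performance by blast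
qed

end
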